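(* If $L$ is accepted by a DFA with $n$ states and $L$ is not prefix-free, then there exists a witness $(v,w)$ to the failure of prefix-freeness with $|w| \le 2n-1$. The bound is best possible: for every $n \ge 1$ there is a DFA with $n$ states whose language is not prefix-free and every witness $(v,w)$ of which satisfies $|w| \ge 2n-1$.
   Context: A word $v$ is a prefix of $w$ if $w = vx$ for some word $x$. $L$ is prefix-free if no word of $L$ has a proper prefix (a prefix different from itself) in $L$. A witness to the failure of prefix-freeness is a pair $(v,w)$ with $v,w \in L$, $v$ a prefix of $w$ and $v \neq w$. *)

theory Defs
  imports Main "HOL-Library.Sublist"
begin

record ('q, 'a) dfa =
  states :: "'q set"
  alphabet :: "'a set"
  delta :: "'q \<Rightarrow> 'a \<Rightarrow> 'q"
  initial :: 'q
  finals :: "'q set"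

text \<open>The DFAs are complete: the transition function is total on
  \<open>states M \<times> alphabet M\<close>; its values elsewhere are irrelevant.\<close>

definition is_dfa :: "('q, 'a) dfa \<Rightarrow> bool" where
  "is_dfa M \<longleftrightarrow>
     finite (states M) \<and> finite (alphabet M) \<and>
     (\<forall>q\<in>states M. \<forall>a\<in>alphabet M. delta M q a \<in> states M) \<and>
     initial M \<in> states M \<and> finals M \<subseteq> states M"

definition language :: "('q, 'a) dfa \<Rightarrow> 'a list set" where
  "language M = {w \<in> lists (alphabet M). foldl (delta M) (initial M) w \<in> finals M}"

definition prefix_free :: "'a list set \<Rightarrow> bool" where
  "prefix_free L \<longleftrightarrow> (\<forall>w\<in>L. \<not> (\<exists>v\<in>L. prefix v w \<and> v \<noteq> w))"

definition prefix_free_witness :: "'a list set \<Rightarrow> 'a list \<times> 'a list \<Rightarrow> bool" where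
  "prefix_free_witness L = (\<lambda>(v, w). v \<in> L \<and> w \<in> L \<and> prefix v w \<and> v \<noteq> w)"

end

theory Submission
  imports Defs
begin

text \<open>
  Cutting loops, a final state is reached by some \<open>v\<close> of length at most \<open>n - 1\<close>, and from there
  another final state by one letter followed by a loop-free path of length at most \<open>n - 1\<close>.
  A unary cycle of \<open>n\<close> states whose only final state is the last one attains the bound: its
  words have lengths \<open>n - 1, 2n - 1, \<dots>\<close>.
\<close>

lemma foldl_delta_in_states:
  assumes "is_dfa M" "q \<in> states M" "w \<in> lists (alphabet M)"
  shows "foldl (delta M) q w \<in> states M"
  using assms(2,3) by (induction w arbitrary: q) (use assms(1) in \<open>auto simp: is_dfa_def\<close>)

text \<open>Pigeonhole: a run on at least \<open>card (states M)\<close> letters visits some state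
  twice, and cutting out the letters read between the two visits leaves the endpoint unchanged.
  Induction on the length repeats the cut until the word is short.\<close>

lemma short_path:
  assumes "is_dfa M" "q \<in> states M" "w \<in> lists (alphabet M)"
  obtains u where "u \<in> lists (alphabet M)" "foldl (delta M) q u = foldl (delta M) q w"
    "length u < card (states M)"
proof -
  have "\<exists>u\<in>lists (alphabet M). foldl (delta M) q u = foldl (delta M) q w \<and>
      length u < card (states M)"
    using assms(3)
  proof (induction w rule: length_induct)
    case (1 w)
    show ?case
    proof (cases "length w < card (states M)")
      case True
      with 1 show ?thesis by blast
    next
      case False
      let ?f = "\<lambda>i. foldl (delta M) q (take i w)"
      have fin: "finite (states M)"
        using assms(1) by (simp add: is_dfa_def)
      have img: "?f ` {..length w} \<subseteq> states M"
        using foldl_delta_in_states[OF assms(1,2)] 1(2) by (auto dest: in_set_takeD)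
      \<comment> \<open>The run passes through \<open>length w + 1\<close> positions, counting the
        start, which exceeds the number of states.\<close>
      have "\<not> inj_on ?f {..length w}"
        using card_inj_on_le[OF _ img fin] False by auto
      then obtain i j where ij: "i < j" "j \<le> length w" "?f i = ?f j"
        by (auto simp: inj_on_def) (metis linorder_neqE_nat)
      \<comment> \<open>Both prefixes end in the same state, so the remaining letters
        \<open>drop j w\<close> lead to the same endpoint from either.\<close>
      let ?u = "take i w @ drop j w"
      have "foldl (delta M) q ?u = foldl (delta M) q (take j w @ drop j w)"
        using ij(3) by (simp only: foldl_append)
      then have "foldl (delta M) q ?u = foldl (delta M) q w"
        by simp
      moreover have "?u \<in> lists (alphabet M)"
        using 1(2) by (auto dest: in_set_takeD in_set_dropD)
      moreover have "length ?u < length w"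
        using ij by simp
      ultimately show ?thesis
        using 1(1) by metis
    qed
  qed
  with that show thesis by blast
qed

lemma short_prefix_free_witness:
  assumes "is_dfa M" "\<not> prefix_free (language M)"
  obtains v w where "prefix_free_witness (language M) (v, w)" "length w \<le> 2 * card (states M) - 1"
proof -
  let ?run = "foldl (delta M)"
  have init: "initial M \<in> states M"
    using assms(1) by (simp add: is_dfa_def)
  obtain v x where "v \<in> language M" "v @ x \<in> language M" "x \<noteq> []"
    using assms(2) by (auto simp: prefix_free_def prefix_def)
  \<comment> \<open>The first letter \<open>a\<close> of the extension is split off and never cut:
    shortening the whole extension could leave the empty word, and then the two words would
    coincide.\<close>
  then obtain a y where v: "v \<in> lists (alphabet M)" "?run (initial M) v \<in> finals M"
    and a: "a \<in> alphabet M" and y: "y \<in> lists (alphabet M)"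
    and w: "?run (delta M (?run (initial M) v) a) y \<in> finals M"
    by (cases x) (auto simp: language_def)
  obtain v' where v': "v' \<in> lists (alphabet M)" "?run (initial M) v' = ?run (initial M) v"
      "length v' < card (states M)"
    using short_path[OF assms(1) init v(1)] .
  have "delta M (?run (initial M) v) a \<in> states M"
    using foldl_delta_in_states[OF assms(1) init v(1)] a assms(1) by (simp add: is_dfa_def)
  then obtain y' where y': "y' \<in> lists (alphabet M)"
      "?run (delta M (?run (initial M) v) a) y' = ?run (delta M (?run (initial M) v) a) y"
      "length y' < card (states M)"
    using short_path[OF assms(1) _ y] by blast
  have "prefix_free_witness (language M) (v', v' @ a # y')"
    using v' y' v a w by (auto simp: prefix_free_witness_def language_def)
  \<comment> \<open>At most (n - 1) + 1 + (n - 1) letters, where n is the number of states.\<close>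
  moreover have "length (v' @ a # y') \<le> 2 * card (states M) - 1"
    using v'(3) y'(3) by simp
  ultimately show thesis using that by blast
qed

text \<open>The states are the residues modulo \<open>n\<close>, so a run records the length of the
  word read. Taking \<open>undefined\<close> as the only letter makes the example available over
  every letter type \<open>'a\<close>.\<close>

definition unary_cycle :: "nat \<Rightarrow> (nat, 'a) dfa" where
  "unary_cycle n = \<lparr>states = {..<n}, alphabet = {undefined},
     delta = (\<lambda>q _. Suc q mod n), initial = 0, finals = {n - 1}\<rparr>"

lemma unary_cycle_is_dfa:
  "n \<ge> 1 \<Longrightarrow> is_dfa (unary_cycle n)"
  by (auto simp: is_dfa_def unary_cycle_def)

lemma foldl_Suc_mod: "foldl (\<lambda>q _. Suc q mod n) 0 w = length w mod n"
  by (induction w rule: rev_induct) (auto simp: mod_Suc_eq)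

lemma language_unary_cycle:
  "language (unary_cycle n) = {w \<in> lists {undefined}. length w mod n = n - 1}"
  by (simp add: language_def unary_cycle_def foldl_Suc_mod)

lemma unary_cycle_not_prefix_free:
  assumes "n \<ge> 1"
  shows "\<not> prefix_free (language (unary_cycle n :: (nat, 'a) dfa))"
proof -
  \<comment> \<open>\<open>?v\<close> is the shortest accepted word, and \<open>?x\<close> goes once
    around the cycle.\<close>
  let ?v = "replicate (n - 1) (undefined :: 'a)" and ?x = "replicate n (undefined :: 'a)"
  have "(n - 1 + n) mod n = n - 1"
    using assms by (subst mod_add_self2) simp
  then have "?v \<in> language (unary_cycle n)" "?v @ ?x \<in> language (unary_cycle n)"
    using assms by (auto simp: language_unary_cycle)
  moreover have "prefix ?v (?v @ ?x)" "?v \<noteq> ?v @ ?x"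
    using assms by auto
  ultimately show ?thesis
    unfolding prefix_free_def by blast
qed

text \<open>The lengths of \<open>v\<close> and \<open>w\<close> are congruent modulo
  \<open>n\<close> and distinct, hence at least \<open>n\<close> apart, while \<open>v\<close>
  itself already has at least \<open>n - 1\<close> letters.\<close>

lemma unary_cycle_witness_length:
  assumes "n \<ge> 1" and "prefix_free_witness (language (unary_cycle n)) (v, w)"
  shows "2 * n - 1 \<le> length w"
proof -
  have v: "length v mod n = n - 1" and w: "length w mod n = n - 1"
    and "prefix v w" "v \<noteq> w"
    using assms(2) by (auto simp: prefix_free_witness_def language_unary_cycle)
  then have less: "length v < length w"
    by (simp add: prefix_length_less strict_prefix_def)
  then have "n dvd length w - length v"
    using mod_eq_dvd_iff_nat[of "length v" "length w" n] v w by simp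
  then have "n \<le> length w - length v"
    using less by (simp add: dvd_imp_le)
  \<comment> \<open>A remainder never exceeds the number divided.\<close>
  moreover have "n - 1 \<le> length v"
    using v mod_less_eq_dividend by metis
  ultimately show ?thesis
    using less by linarith
qed

theorem theorem12:
  shows "(\<forall>(L :: 'a list set) (M :: ('q, 'a) dfa) n.
            is_dfa M \<and> card (states M) = n \<and> language M = L \<and> \<not> prefix_free L \<longrightarrow>
            (\<exists>v w. prefix_free_witness L (v, w) \<and> length w \<le> 2 * n - 1))
       \<and> (\<forall>n\<ge>1. \<exists>M :: (nat, 'a) dfa.
            is_dfa M \<and> card (states M) = n \<and> \<not> prefix_free (language M) \<and>
            (\<forall>v w. prefix_free_witness (language M) (v, w) \<longrightarrow> length w \<ge> 2 * n - 1))"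
proof (intro conjI allI impI)
  fix L :: "'a list set" and M :: "('q, 'a) dfa" and n
  assume "is_dfa M \<and> card (states M) = n \<and> language M = L \<and> \<not> prefix_free L"
  then show "\<exists>v w. prefix_free_witness L (v, w) \<and> length w \<le> 2 * n - 1"
    using short_prefix_free_witness by blast
next
  fix n :: nat
  assume n: "n \<ge> 1"
  have "card (states (unary_cycle n :: (nat, 'a) dfa)) = n"
    by (simp add: unary_cycle_def)
  with n show "\<exists>M :: (nat, 'a) dfa.
            is_dfa M \<and> card (states M) = n \<and> \<not> prefix_free (language M) \<and>
            (\<forall>v w. prefix_free_witness (language M) (v, w) \<longrightarrow> length w \<ge> 2 * n - 1)"
    using unary_cycle_is_dfa unary_cycle_not_prefix_free unary_cycle_witness_length by blast
qed

end
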